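(* Let $G=(V,E)$ be an infinite, connected, locally finite, simple undirected graph, let $\kappa^*:E\to\mathbb{R}$ and let $\omega_0:E\to(0,\infty)$. Assume that: (1) $D:=\sup_{x\in V}d_x<\infty$; (2) $\|\kappa^*\|_\infty:=\sup_{e\in E}|\kappa^*(e)|<\infty$; (3) there exists $\delta>0$ such that $\delta^{-1}\le\omega_0(e)\le\delta$ for every $e\in E$. Then the solution $\omega$ on $[0,\infty)$ of the Ricci flow $$\frac{d}{dt}\omega(t,e)=-(\kappa(t,e)-\kappa^*(e))\,\omega(t,e),\qquad t>0,\ e\in E,$$ with initial value $\omega(0,\cdot)=\omega_0$ is unique; that is, any two solutions with this initial value coincide on $[0,\infty)\times E$.
   Context: $d_x$ is the number of neighbours of $x$. Lin-Lu-Yau curvature. Let $d(x,y)$ be the combinatorial graph distance. Given positive edge weights $\omega:E\to(0,\infty)$, put $m(x)=\sum_{y\sim x}\omega_{xy}$ and, for $\alpha\in(0,1)$, let $m_x^\alpha$ be the probability measure on $V$ with $m_x^\alpha(x)=\alpha$, $m_x^\alpha(y)=(1-\alpha)\omega_{xy}/m(x)$ for $y\sim x$, and $0$ otherwise. Let $W$ be the $1$-Wasserstein distance with cost $d$. For $x\ne y$, $\kappa(x,y)=\lim_{\alpha\to1^-}\frac{1}{1-\alpha}\left(1-\frac{W(m_x^\alpha,m_y^\alpha)}{d(x,y)}\right)$; for an edge $e=(x,y)$ write $\kappa_e=\kappa(x,y)$. Equivalently, $\kappa(x,y)=\inf\{\nabla_{xy}\Delta f:\ f\text{ is }1\text{-Lipschitz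 w.r.t. }d,\ \nabla_{yx}f=1\}$, where $\Delta f(x)=\frac1{m(x)}\sum_{z\sim x}\omega_{xz}(f(z)-f(x))$ and $\nabla_{xy}f=\frac{f(x)-f(y)}{d(x,y)}$. The distance $d$ is the fixed graph distance and does not depend on $\omega$. In the flow, $\kappa(t,e)$ is the Lin-Lu-Yau curvature of $e$ computed with the edge weights $\omega(t,\cdot)$. A solution is a family of positive functions $\omega(\cdot,e)$, continuous on $[0,\infty)$ and continuously differentiable on $(0,\infty)$, satisfying the equation for $t>0$ and the initial condition at $t=0$. *)

theory Defs
  imports "HOL-Probability.Probability"
begin

definition simple_graph :: "'a set \<Rightarrow> 'a set set \<Rightarrow> bool" where
  "simple_graph V E \<longleftrightarrow> (\<forall>e\<in>E. \<exists>x\<in>V. \<exists>y\<in>V. x \<noteq> y \<and> e = {x, y})"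

definition adj_rel :: "'a set set \<Rightarrow> ('a \<times> 'a) set" where
  "adj_rel E = {(x, y). {x, y} \<in> E}"

definition nbrs :: "'a set set \<Rightarrow> 'a \<Rightarrow> 'a set" where
  "nbrs E x = {y. {x, y} \<in> E}"

definition vertex_degree :: "'a set set \<Rightarrow> 'a \<Rightarrow> nat" where
  "vertex_degree E x = card (nbrs E x)"

definition locally_finite_graph :: "'a set \<Rightarrow> 'a set set \<Rightarrow> bool" where
  "locally_finite_graph V E \<longleftrightarrow> (\<forall>x\<in>V. finite (nbrs E x))"

definition connected_graph :: "'a set \<Rightarrow> 'a set set \<Rightarrow> bool" where
  "connected_graph V E \<longleftrightarrow> (\<forall>x\<in>V. \<forall>y\<in>V. (x, y) \<in> (adj_rel E)\<^sup>*)"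

text \<open>The length of a shortest path; meaningful only if \<open>y\<close> is reachable from \<open>x\<close>.\<close>

definition gdist :: "'a set set \<Rightarrow> 'a \<Rightarrow> 'a \<Rightarrow> nat" where
  "gdist E x y = (LEAST n. (x, y) \<in> adj_rel E ^^ n)"

definition vertex_weight :: "'a set set \<Rightarrow> ('a set \<Rightarrow> real) \<Rightarrow> 'a \<Rightarrow> real" where
  "vertex_weight E w x = (\<Sum>y\<in>nbrs E x. w {x, y})"

text \<open>
  \<^const>\<open>embed_pmf\<close> requires a nonnegative function of total mass one; the lemma below
  shows that this holds for positive weights at every non-isolated vertex of finite degree.
\<close>

definition lazy_walk :: "'a set set \<Rightarrow> ('a set \<Rightarrow> real) \<Rightarrow> real \<Rightarrow> 'a \<Rightarrow> 'a pmf" where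
  "lazy_walk E w \<alpha> x = embed_pmf (\<lambda>y.
     if y = x then \<alpha>
     else if y \<in> nbrs E x then (1 - \<alpha>) * w {x, y} / vertex_weight E w x
     else 0)"

lemma pmf_lazy_walk:
  assumes G: "simple_graph V E" and fin: "finite (nbrs E x)" and ne: "nbrs E x \<noteq> {}"
    and pos: "\<And>e. e \<in> E \<Longrightarrow> 0 < w e" and \<alpha>: "0 < \<alpha>" "\<alpha> < 1"
  shows "pmf (lazy_walk E w \<alpha> x) y =
    (if y = x then \<alpha>
     else if y \<in> nbrs E x then (1 - \<alpha>) * w {x, y} / vertex_weight E w x
     else 0)"
proof -
  define f where "f = (\<lambda>y. if y = x then \<alpha>
     else if y \<in> nbrs E x then (1 - \<alpha>) * w {x, y} / vertex_weight E w x else 0)"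
  have xn: "x \<notin> nbrs E x"
  proof
    assume "x \<in> nbrs E x"
    then have "{x} \<in> E" by (simp add: nbrs_def)
    then obtain a b where "a \<noteq> b" "{x} = {a, b}"
      using G unfolding simple_graph_def by blast
    then show False by auto
  qed
  have wpos: "0 < w {x, z}" if "z \<in> nbrs E x" for z
    using that pos by (simp add: nbrs_def)
  have m: "0 < vertex_weight E w x"
    unfolding vertex_weight_def using fin ne wpos by (intro sum_pos) auto
  have nn: "0 \<le> f z" for z
    using \<alpha> m wpos[of z] by (auto simp: f_def intro!: divide_nonneg_pos mult_nonneg_nonneg)
  have "sum f (insert x (nbrs E x)) = \<alpha> + sum f (nbrs E x)"
    using fin xn by (simp add: f_def)
  also have "sum f (nbrs E x) = (\<Sum>z\<in>nbrs E x. (1 - \<alpha>) * w {x, z} / vertex_weight E w x)"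
    by (rule sum.cong) (use xn in \<open>auto simp: f_def\<close>)
  also have "\<dots> = (1 - \<alpha>) * (\<Sum>z\<in>nbrs E x. w {x, z}) / vertex_weight E w x"
    by (simp add: sum_divide_distrib sum_distrib_left)
  also have "\<dots> = 1 - \<alpha>"
    using m by (simp add: vertex_weight_def)
  finally have s: "sum f (insert x (nbrs E x)) = 1" by simp
  have "(\<integral>\<^sup>+ z. ennreal (f z) \<partial>count_space UNIV) = (\<Sum>z\<in>insert x (nbrs E x). ennreal (f z))"
    using fin by (intro nn_integral_count_space') (auto simp: f_def)
  also have "\<dots> = ennreal (sum f (insert x (nbrs E x)))"
    using nn by (simp only: sum_ennreal)
  also have "\<dots> = 1" using s by simp
  finally have "pmf (embed_pmf f) y = f y"
    using nn by (intro pmf_embed_pmf) auto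
  then show ?thesis by (simp add: f_def lazy_walk_def)
qed

text \<open>
  The integral is a Bochner integral, which is 0 for non-integrable costs; for finitely
  supported marginals, such as the lazy walks above, every coupling is finitely supported.
\<close>

definition wasserstein1 :: "('a \<Rightarrow> 'a \<Rightarrow> real) \<Rightarrow> 'a pmf \<Rightarrow> 'a pmf \<Rightarrow> real" where
  "wasserstein1 c \<mu> \<nu> =
     (INF \<pi>\<in>{\<pi>. map_pmf fst \<pi> = \<mu> \<and> map_pmf snd \<pi> = \<nu>}.
        measure_pmf.expectation \<pi> (\<lambda>(u, v). c u v))"

definition lly_curvature :: "'a set set \<Rightarrow> ('a set \<Rightarrow> real) \<Rightarrow> 'a \<Rightarrow> 'a \<Rightarrow> real" where
  "lly_curvature E w x y =
     Lim (at_left 1) (\<lambda>\<alpha>. 1 / (1 - \<alpha>) *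
       (1 - wasserstein1 (\<lambda>u v. real (gdist E u v)) (lazy_walk E w \<alpha> x) (lazy_walk E w \<alpha> y)
            / real (gdist E x y)))"

text \<open>
  Weights are functions on unordered edges; only their values on \<open>E\<close> and at times
  \<open>t \<ge> 0\<close> matter. The curvature of an edge is \<^const>\<open>lly_curvature\<close> of its endpoints,
  in either order.
\<close>

definition ricci_flow_solution ::
    "'a set set \<Rightarrow> ('a set \<Rightarrow> real) \<Rightarrow> ('a set \<Rightarrow> real) \<Rightarrow> (real \<Rightarrow> 'a set \<Rightarrow> real) \<Rightarrow> bool" where
  "ricci_flow_solution E \<kappa>s w0 w \<longleftrightarrow>
     (\<forall>e\<in>E. (\<forall>t\<ge>0. 0 < w t e) \<and>
            continuous_on {0..} (\<lambda>t. w t e) \<and>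
            (\<lambda>t. w t e) C1_differentiable_on {0<..} \<and>
            w 0 e = w0 e) \<and>
     (\<forall>x y. {x, y} \<in> E \<longrightarrow>
        (\<forall>t>0. ((\<lambda>s. w s {x, y}) has_real_derivative
                  - (lly_curvature E (w t) x y - \<kappa>s {x, y}) * w t {x, y}) (at t)))"

end

theory Submission
  imports Defs
begin

text \<open>
  The curvature of an edge is Lipschitz in the logarithms of the weights, uniformly over the graph.
  If \<open>\<bar>ln w - ln w'\<bar> \<le> s\<close> on all edges, then the transition probabilities of \<open>w\<close> are at least
  \<open>c = exp (-2 * s)\<close> times those of \<open>w'\<close>. Thus a coupling for \<open>w'\<close> extends to one for \<open>w\<close> by coupling the
  remaining mass arbitrarily, which gives \<open>\<kappa> + 2 \<ge> c * (\<kappa>' + 2)\<close>; since \<open>-2 \<le> \<kappa> \<le> 2\<close>,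
  the curvatures differ by at most \<open>min 4 (8 * s)\<close>. For two solutions, \<open>ln \<omega>1 - ln \<omega>2\<close> has derivative
  \<open>\<kappa>2 - \<kappa>1\<close>, and Picard iteration of this estimate, started from the bound 4, makes the difference zero.
\<close>

section \<open>Mixtures of probability mass functions\<close>

definition mix_pmf :: "real \<Rightarrow> 'a pmf \<Rightarrow> 'a pmf \<Rightarrow> 'a pmf" where
  "mix_pmf c p q = bind_pmf (bernoulli_pmf c) (\<lambda>b. if b then p else q)"

lemma pmf_mix_pmf:
  assumes "0 \<le> c" "c \<le> 1"
  shows "pmf (mix_pmf c p q) x = c * pmf p x + (1 - c) * pmf q x"
  using assms by (simp add: mix_pmf_def pmf_bind algebra_simps)

lemma map_mix_pmf: "map_pmf f (mix_pmf c p q) = mix_pmf c (map_pmf f p) (map_pmf f q)"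
  unfolding mix_pmf_def map_bind_pmf by (intro bind_pmf_cong) auto

lemma set_mix_pmf: "set_pmf (mix_pmf c p q) \<subseteq> set_pmf p \<union> set_pmf q"
  by (auto simp: mix_pmf_def split: if_splits)

lemma expectation_mix_pmf:
  fixes f :: "'a \<Rightarrow> real"
  assumes c: "0 \<le> c" "c \<le> 1" and fin: "finite (set_pmf p)" "finite (set_pmf q)"
  shows "measure_pmf.expectation (mix_pmf c p q) f =
    c * measure_pmf.expectation p f + (1 - c) * measure_pmf.expectation q f"
proof -
  let ?A = "set_pmf p \<union> set_pmf q"
  have "measure_pmf.expectation r f = (\<Sum>a\<in>?A. f a * pmf r a)" if "set_pmf r \<subseteq> ?A" for r
    using that fin by (intro integral_measure_pmf_real) auto
  then show ?thesis
    using c set_mix_pmf[of c p q]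
    by (simp add: pmf_mix_pmf distrib_left sum.distrib sum_distrib_left mult.left_commute)
qed

text \<open>The remainder is \<open>(p - c * p') / (1 - c)\<close>: domination makes it nonnegative,
  and subtracting mass \<open>c\<close> from mass 1 makes its total mass 1 after normalisation. The
  hypothesis \<open>c < 1\<close> makes this division legitimate.\<close>

lemma ex_mix_pmf_of_dominated:
  assumes c: "0 \<le> c" "c < 1" and fin: "finite (set_pmf p)"
    and le: "\<And>z. c * pmf p' z \<le> pmf p z"
  obtains q where "p = mix_pmf c p' q" "set_pmf q \<subseteq> set_pmf p"
proof -
  define f where "f z = (pmf p z - c * pmf p' z) / (1 - c)" for z
  have nn: "0 \<le> f z" for z using c le[of z] by (simp add: f_def)
  have out: "f z = 0" if "z \<notin> set_pmf p" for z
  proof -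
    have "0 \<le> c * pmf p' z" using c by simp
    then show ?thesis using that le[of z] by (simp add: f_def set_pmf_iff)
  qed
  \<comment> \<open>For \<open>c = 0\<close> domination says nothing about the support of
    \<open>p'\<close>. Otherwise that support lies in \<open>set_pmf p\<close>, so the finite sum
    below captures the whole mass of \<open>p'\<close>.\<close>
  have sub: "set_pmf p' \<subseteq> set_pmf p" if "c \<noteq> 0"
  proof
    fix z assume "z \<in> set_pmf p'"
    then have "0 < c * pmf p' z" using c that by (simp add: pmf_positive)
    then show "z \<in> set_pmf p" using le[of z] by (auto simp: set_pmf_iff)
  qed
  have "c * (\<Sum>z\<in>set_pmf p. pmf p' z) = c"
    using sub fin by (cases "c = 0") (auto simp: sum_pmf_eq_1)
  then have "sum f (set_pmf p) = 1"
    using c fin by (simp add: f_def sum_divide_distrib[symmetric] sum_subtractf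
        sum_distrib_left[symmetric] sum_pmf_eq_1)
  moreover have "(\<integral>\<^sup>+ z. ennreal (f z) \<partial>count_space UNIV) = (\<Sum>z\<in>set_pmf p. ennreal (f z))"
    using fin out by (intro nn_integral_count_space') auto
  ultimately have s: "(\<integral>\<^sup>+ z. ennreal (f z) \<partial>count_space UNIV) = 1"
    using nn by (simp add: sum_ennreal)
  have pmf_q: "pmf (embed_pmf f) z = f z" for z using nn s by (intro pmf_embed_pmf) auto
  show ?thesis
  proof
    show "p = mix_pmf c p' (embed_pmf f)"
      using c by (intro pmf_eqI) (simp add: pmf_mix_pmf pmf_q, simp add: f_def)
    show "set_pmf (embed_pmf f) \<subseteq> set_pmf p"
      by (intro subsetI) (metis out pmf_q set_pmf_iff)
  qed
qed

section \<open>Couplings and transport cost\<close>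

lemma finite_set_coupling:
  assumes "finite (set_pmf (map_pmf fst \<pi>))" "finite (set_pmf (map_pmf snd \<pi>))"
  shows "finite (set_pmf \<pi>)"
proof (rule finite_subset)
  show "set_pmf \<pi> \<subseteq> set_pmf (map_pmf fst \<pi>) \<times> set_pmf (map_pmf snd \<pi>)" by force
qed (use assms in blast)

text \<open>A real \<open>INF\<close> is a lower bound only for sets bounded below; nonnegative
  costs provide the bound 0.\<close>

lemma wasserstein1_le:
  assumes "\<And>u v. 0 \<le> d u v" "map_pmf fst \<pi> = \<mu>" "map_pmf snd \<pi> = \<nu>"
  shows "wasserstein1 d \<mu> \<nu> \<le> measure_pmf.expectation \<pi> (\<lambda>(u, v). d u v)"
  unfolding wasserstein1_def
  by (rule cINF_lower) (use assms in \<open>auto intro!: bdd_belowI2[where m = 0] integral_nonneg_AE\<close>)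

text \<open>The product coupling shows that the infimum ranges over a nonempty set.\<close>

lemma wasserstein1_ge:
  assumes "\<And>\<pi>. map_pmf fst \<pi> = \<mu> \<Longrightarrow> map_pmf snd \<pi> = \<nu> \<Longrightarrow>
     L \<le> measure_pmf.expectation \<pi> (\<lambda>(u, v). d u v)"
  shows "L \<le> wasserstein1 d \<mu> \<nu>"
  unfolding wasserstein1_def
  by (rule cINF_greatest)
    (use assms map_fst_pair_pmf map_snd_pair_pmf in \<open>blast+\<close>)

text \<open>A coupling of \<open>\<mu>\<close> and \<open>\<nu>\<close>, mixed with the product
  coupling of \<open>\<mu>'\<close> and \<open>\<nu>'\<close>, couples the two mixtures. The product
  part costs at most \<open>K\<close>, since \<open>K\<close> bounds the cost on its
  support.\<close>

lemma wasserstein1_mix_le: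
  fixes d :: "'a \<Rightarrow> 'a \<Rightarrow> real"
  assumes c: "0 \<le> c" "c \<le> 1" and d: "\<And>u v. 0 \<le> d u v"
    and fin: "finite (set_pmf \<mu>)" "finite (set_pmf \<nu>)" "finite (set_pmf \<mu>')" "finite (set_pmf \<nu>')"
    and K: "\<And>u v. u \<in> set_pmf \<mu>' \<Longrightarrow> v \<in> set_pmf \<nu>' \<Longrightarrow> d u v \<le> K"
  shows "wasserstein1 d (mix_pmf c \<mu> \<mu>') (mix_pmf c \<nu> \<nu>') \<le> c * wasserstein1 d \<mu> \<nu> + (1 - c) * K"
    (is "?W \<le> _")
proof -
  let ?E = "\<lambda>\<pi>. measure_pmf.expectation \<pi> (\<lambda>(u, v). d u v)"
  let ?\<rho> = "pair_pmf \<mu>' \<nu>'"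
  have "?E ?\<rho> \<le> measure_pmf.expectation ?\<rho> (\<lambda>_. K)"
    using fin K by (intro integral_mono_AE integrable_measure_pmf_finite) (auto simp: AE_measure_pmf_iff)
  then have \<rho>: "?E ?\<rho> \<le> K" by simp
  have W: "?W \<le> c * ?E \<pi> + (1 - c) * K" if \<pi>: "map_pmf fst \<pi> = \<mu>" "map_pmf snd \<pi> = \<nu>" for \<pi>
  proof -
    have "finite (set_pmf \<pi>)" using \<pi> fin finite_set_coupling by blast
    then have "?E (mix_pmf c \<pi> ?\<rho>) = c * ?E \<pi> + (1 - c) * ?E ?\<rho>"
      using c fin by (intro expectation_mix_pmf) auto
    moreover have "?W \<le> ?E (mix_pmf c \<pi> ?\<rho>)"
      by (rule wasserstein1_le) (simp_all add: d map_mix_pmf \<pi> map_fst_pair_pmf map_snd_pair_pmf)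
    moreover have "(1 - c) * ?E ?\<rho> \<le> (1 - c) * K"
      using c \<rho> by (intro mult_left_mono) auto
    ultimately show ?thesis by linarith
  qed
  show ?thesis
  \<comment> \<open>For positive \<open>c\<close> the estimate is solved for the expectation under
    an arbitrary coupling and then passed to the infimum. This divides by \<open>c\<close>, so
    \<open>c = 0\<close> is treated with a single coupling.\<close>
  proof (cases "c = 0")
    case True
    then show ?thesis using W[of "pair_pmf \<mu> \<nu>"] by (simp add: map_fst_pair_pmf map_snd_pair_pmf)
  next
    case False
    then have "(?W - (1 - c) * K) / c \<le> wasserstein1 d \<mu> \<nu>"
      using c W by (intro wasserstein1_ge) (auto simp: field_simps)
    then show ?thesis using c False by (simp add: field_simps)
  qed
qed

text \<open>Pointwise, the indicator of \<open>u = x\<close> plus the indicator of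
  \<open>v = y\<close> minus 1 is at most \<open>d u v\<close>: it is positive only at the pair of
  \<open>x\<close> and \<open>y\<close>, where it equals 1. Integrating against any coupling gives
  the bound.\<close>

lemma wasserstein1_ge_atoms:
  fixes d :: "'a \<Rightarrow> 'a \<Rightarrow> real"
  assumes d: "\<And>u v. 0 \<le> d u v" "1 \<le> d x y" and fin: "finite (set_pmf \<mu>)" "finite (set_pmf \<nu>)"
  shows "pmf \<mu> x + pmf \<nu> y - 1 \<le> wasserstein1 d \<mu> \<nu>"
proof (rule wasserstein1_ge)
  fix \<pi> assume \<pi>: "map_pmf fst \<pi> = \<mu>" "map_pmf snd \<pi> = \<nu>"
  \<comment> \<open>Couplings of finitely supported marginals are finitely supported, so every
    integral here is genuine and not the default 0.\<close>
  then have int: "integrable (measure_pmf \<pi>) f" for f :: "'a \<times> 'a \<Rightarrow> real"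
    using fin finite_set_coupling integrable_measure_pmf_finite by blast
  have E: "measure_pmf.expectation p (indicator {z}) = pmf p z" for p :: "'a pmf" and z
    by (simp add: measure_pmf_single)
  have "pmf \<mu> x + pmf \<nu> y - 1 =
      measure_pmf.expectation \<pi> (\<lambda>w. indicator {x} (fst w) + indicator {y} (snd w) - 1)"
    using int \<pi> E[of \<mu> x] E[of \<nu> y]
    by (simp add: Bochner_Integration.integral_diff Bochner_Integration.integral_add
        integral_map_pmf[symmetric] del: integral_map_pmf integral_indicator)
  also have "\<dots> \<le> measure_pmf.expectation \<pi> (\<lambda>(u, v). d u v)"
    using d by (intro integral_mono int) (auto split: split_indicator intro: order_trans[of _ 0])
  finally show "pmf \<mu> x + pmf \<nu> y - 1 \<le> measure_pmf.expectation \<pi> (\<lambda>(u, v). d u v)" .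
qed

section \<open>Graph distances near an edge\<close>

lemma gdist_le: "(x, y) \<in> adj_rel E ^^ n \<Longrightarrow> gdist E x y \<le> n"
  unfolding gdist_def by (rule Least_le)

lemma gdist_adj:
  assumes "{x, y} \<in> E" "x \<noteq> y"
  shows "gdist E x y = 1"
proof -
  have 1: "(x, y) \<in> adj_rel E ^^ 1" using assms by (simp add: adj_rel_def)
  then have "(x, y) \<in> adj_rel E ^^ gdist E x y" unfolding gdist_def by (rule LeastI)
  then have "gdist E x y \<noteq> 0" using assms by (metis IdE relpow.simps(1) Pair_inject)
  then show ?thesis using gdist_le[OF 1] by linarith
qed

text \<open>The walk through \<open>u\<close>, \<open>x\<close>, \<open>y\<close>, \<open>v\<close>
  has at most three steps. The first and last may be absent.\<close>

lemma gdist_balls_le: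
  assumes "{x, y} \<in> E" "u \<in> insert x (nbrs E x)" "v \<in> insert y (nbrs E y)"
  shows "gdist E u v \<le> 3"
proof -
  let ?R = "adj_rel E"
  have xy: "(x, y) \<in> ?R" using assms by (simp add: adj_rel_def)
  have u: "u = x \<or> (u, x) \<in> ?R" and v: "v = y \<or> (y, v) \<in> ?R"
    using assms by (auto simp: adj_rel_def nbrs_def insert_commute)
  have "\<exists>n\<le>1. (u, x) \<in> ?R ^^ n"
    using u by (metis le_refl relpow_0_I relpow_1 zero_le)
  moreover have "\<exists>n\<le>1. (y, v) \<in> ?R ^^ n"
    using v by (metis le_refl relpow_0_I relpow_1 zero_le)
  ultimately obtain m n where "m \<le> 1" "n \<le> 1" "(u, x) \<in> ?R ^^ m" "(y, v) \<in> ?R ^^ n" by blast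
  moreover from this xy have "(u, v) \<in> ?R ^^ (Suc m + n)"
    by (metis relpow_Suc_I relpow_trans)
  then have "gdist E u v \<le> Suc m + n" by (rule gdist_le)
  ultimately show ?thesis by linarith
qed

section \<open>Curvature of a single edge\<close>

definition walk_distance :: "'a set set \<Rightarrow> ('a set \<Rightarrow> real) \<Rightarrow> 'a \<Rightarrow> 'a \<Rightarrow> real \<Rightarrow> real" where
  "walk_distance E w x y \<alpha> =
     wasserstein1 (\<lambda>u v. real (gdist E u v)) (lazy_walk E w \<alpha> x) (lazy_walk E w \<alpha> y)"

locale graph_edge =
  fixes V :: "'a set" and E :: "'a set set" and x y :: 'a
  assumes graph: "simple_graph V E" "locally_finite_graph V E" and edge: "{x, y} \<in> E"
begin

lemma ends_in_V: "x \<in> V" "y \<in> V" "x \<noteq> y"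
  using graph(1) edge unfolding simple_graph_def by (metis doubleton_eq_iff)+

lemma finite_nbrs: "z \<in> {x, y} \<Longrightarrow> finite (nbrs E z)"
  using graph(2) ends_in_V unfolding locally_finite_graph_def by blast

lemma nbrs_nonempty: "z \<in> {x, y} \<Longrightarrow> nbrs E z \<noteq> {}"
  using edge by (auto simp: nbrs_def insert_commute)

lemma pmf_walk:
  assumes "\<forall>e\<in>E. 0 < w e" "0 < \<alpha>" "\<alpha> < 1" "z \<in> {x, y}"
  shows "pmf (lazy_walk E w \<alpha> z) u = (if u = z then \<alpha>
     else if u \<in> nbrs E z then (1 - \<alpha>) * w {z, u} / vertex_weight E w z else 0)"
  using assms finite_nbrs nbrs_nonempty by (intro pmf_lazy_walk[OF graph(1)]) auto

lemma vertex_weight_pos: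
  assumes "\<forall>e\<in>E. 0 < w e" "z \<in> {x, y}"
  shows "0 < vertex_weight E w z"
  unfolding vertex_weight_def using assms finite_nbrs nbrs_nonempty
  by (intro sum_pos) (auto simp: nbrs_def)

lemma set_walk:
  assumes "\<forall>e\<in>E. 0 < w e" "0 < \<alpha>" "\<alpha> < 1" "z \<in> {x, y}"
  shows "set_pmf (lazy_walk E w \<alpha> z) \<subseteq> insert z (nbrs E z)"
  using pmf_walk[OF assms] by (auto simp: set_pmf_iff split: if_splits)

lemma finite_set_walk:
  assumes "\<forall>e\<in>E. 0 < w e" "0 < \<alpha>" "\<alpha> < 1" "z \<in> {x, y}"
  shows "finite (set_pmf (lazy_walk E w \<alpha> z))"
  using set_walk[OF assms] finite_nbrs assms(4) by (meson finite_insert finite_subset)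

text \<open>The transport cost is convex in \<open>\<alpha>\<close> and equals 1 at \<open>\<alpha> = 1\<close>, so these quotients are slopes
  of a concave function.\<close>

lemma walk_quotient_mono:
  assumes w: "\<forall>e\<in>E. 0 < w e" and \<alpha>: "0 < \<alpha>" "\<alpha> \<le> \<beta>" "\<beta> < 1"
  shows "(1 - walk_distance E w x y \<alpha>) / (1 - \<alpha>) \<le> (1 - walk_distance E w x y \<beta>) / (1 - \<beta>)"
proof -
  \<comment> \<open>The walk with the larger laziness \<open>\<beta>\<close> follows the
    \<open>\<alpha>\<close> walk with probability \<open>c\<close> and otherwise stays put;
    \<open>c\<close> matches the probabilities of leaving the vertex. Two walks that stay put are at
    distance 1.\<close>
  define c where "c = (1 - \<beta>) / (1 - \<alpha>)"
  have c: "0 < c" "c \<le> 1" and c_\<alpha>: "c * (1 - \<alpha>) = 1 - \<beta>" using \<alpha> by (auto simp: c_def)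
  have \<beta>: "\<beta> = c * \<alpha> + (1 - c)" using c_\<alpha> by (simp add: algebra_simps)
  have mix: "lazy_walk E w \<beta> z = mix_pmf c (lazy_walk E w \<alpha> z) (return_pmf z)" if "z \<in> {x, y}" for z
  proof (rule pmf_eqI)
    fix u
    show "pmf (lazy_walk E w \<beta> z) u = pmf (mix_pmf c (lazy_walk E w \<alpha> z) (return_pmf z)) u"
      using c \<alpha> \<beta> that
      by (simp add: pmf_mix_pmf pmf_walk[OF w] pmf_return c_\<alpha>[symmetric] indicator_def right_diff_distrib)
  qed
  have "walk_distance E w x y \<beta> \<le> c * walk_distance E w x y \<alpha> + (1 - c) * 1"
    unfolding walk_distance_def mix[of x, simplified] mix[of y, simplified]
    using c \<alpha> by (intro wasserstein1_mix_le)
      (auto simp: finite_set_walk w gdist_adj[OF edge ends_in_V(3)])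
  then have "c * (1 - walk_distance E w x y \<alpha>) \<le> 1 - walk_distance E w x y \<beta>"
    by (simp add: algebra_simps)
  then have "c * (1 - walk_distance E w x y \<alpha>) / (1 - \<beta>) \<le> (1 - walk_distance E w x y \<beta>) / (1 - \<beta>)"
    using \<alpha> by (intro divide_right_mono) auto
  then show ?thesis using \<alpha> by (simp add: c_def)
qed

text \<open>Each walk keeps mass \<open>\<alpha>\<close> at its own endpoint, so the atom bound
  gives transport cost at least \<open>2 * \<alpha> - 1\<close>.\<close>

lemma walk_quotient_le:
  assumes w: "\<forall>e\<in>E. 0 < w e" and \<alpha>: "0 < \<alpha>" "\<alpha> < 1"
  shows "(1 - walk_distance E w x y \<alpha>) / (1 - \<alpha>) \<le> 2"
proof -
  have "pmf (lazy_walk E w \<alpha> x) x + pmf (lazy_walk E w \<alpha> y) y - 1 \<le> walk_distance E w x y \<alpha>"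
    unfolding walk_distance_def using \<alpha>
    by (intro wasserstein1_ge_atoms)
      (auto simp: finite_set_walk w gdist_adj[OF edge ends_in_V(3)])
  then show ?thesis using \<alpha> by (simp add: pmf_walk[OF w] field_simps)
qed

text \<open>The quotients increase with \<open>\<alpha>\<close> and are bounded by 2, hence converge
  to their supremum. Existence of the limit is what ties \<open>Lim\<close> to an actual convergence
  statement.\<close>

lemma lly_curvature_tendsto:
  assumes w: "\<forall>e\<in>E. 0 < w e"
  shows "((\<lambda>\<alpha>. (1 - walk_distance E w x y \<alpha>) / (1 - \<alpha>)) \<longlongrightarrow> lly_curvature E w x y) (at_left 1)"
proof -
  let ?q = "\<lambda>\<alpha>. (1 - walk_distance E w x y \<alpha>) / (1 - \<alpha>)"
  have "(?q \<longlongrightarrow> Sup (?q ` ({..<1} \<inter> {0<..}))) (at 1 within ({..<1} \<inter> {0<..}))"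
    using walk_quotient_mono[OF w] walk_quotient_le[OF w] by (intro Lim_left_bound) auto
  \<comment> \<open>The monotonicity and the bound hold only for positive \<open>\<alpha>\<close>;
    restricting to these does not change the left neighbourhood filter at 1.\<close>
  moreover have "at 1 within ({..<1} \<inter> {0<..}) = at_left (1 :: real)"
    by (rule at_within_nhd[where S = "{0<..}"]) auto
  ultimately have lim: "(?q \<longlongrightarrow> Sup (?q ` ({..<1} \<inter> {0<..}))) (at_left 1)" by simp
  have "lly_curvature E w x y = Lim (at_left 1) ?q"
    by (simp add: lly_curvature_def walk_distance_def gdist_adj[OF edge ends_in_V(3)])
  then show ?thesis using lim tendsto_Lim[OF trivial_limit_at_left_real lim] by simp
qed

lemma eventually_at_left_1: "eventually (\<lambda>\<alpha>::real. 0 < \<alpha> \<and> \<alpha> < 1) (at_left 1)"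
  using eventually_at_left_real[of 0 "1::real"] by (simp add: eventually_mono)

lemma lly_curvature_le:
  assumes w: "\<forall>e\<in>E. 0 < w e"
  shows "lly_curvature E w x y \<le> 2"
  by (rule tendsto_upperbound[OF lly_curvature_tendsto[OF w] _ trivial_limit_at_left_real])
    (auto intro: eventually_mono[OF eventually_at_left_1] walk_quotient_le[OF w])

text \<open>A walk whose transition probabilities are at least \<open>c\<close> times those of another walk is a
  mixture of the other walk and a remainder, and the remainders can be coupled at cost at most 3.\<close>

lemma lly_curvature_dominated:
  assumes w: "\<forall>e\<in>E. 0 < w e" and w': "\<forall>e\<in>E. 0 < w' e" and c: "0 \<le> c" "c < 1"
    and dom: "\<And>z u. z \<in> {x, y} \<Longrightarrow> u \<in> nbrs E z \<Longrightarrow>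
      c * (w' {z, u} / vertex_weight E w' z) \<le> w {z, u} / vertex_weight E w z"
  shows "c * (lly_curvature E w' x y + 2) \<le> lly_curvature E w x y + 2"
proof -
  let ?W = "walk_distance E w x y" and ?W' = "walk_distance E w' x y"
  have main: "c * ((1 - ?W' \<alpha>) / (1 - \<alpha>) + 2) \<le> (1 - ?W \<alpha>) / (1 - \<alpha>) + 2" if \<alpha>: "0 < \<alpha>" "\<alpha> < 1" for \<alpha>
  proof -
    \<comment> \<open>The measure \<open>a * \<mu> z\<close> consists of \<open>c\<close> times the
      \<open>w'\<close> walk plus an atom of mass \<open>(1 - c) * \<alpha>\<close> at
      \<open>z\<close>. It thus has exactly the mass \<open>\<alpha>\<close> of the \<open>w\<close>
      walk at \<open>z\<close>. The uncovered mass is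
      \<open>1 - a = (1 - c) * (1 - \<alpha>)\<close>, small enough that its cost stays bounded
      after division by \<open>1 - \<alpha>\<close>.\<close>
    define a where "a = c + (1 - c) * \<alpha>"
    define b where "b = c / a"
    have "0 < (1 - c) * (1 - \<alpha>)" "0 < (1 - c) * \<alpha>" using c \<alpha> by simp_all
    moreover have "1 - a = (1 - c) * (1 - \<alpha>)" by (simp add: a_def algebra_simps)
    ultimately have a: "0 < a" "a < 1" "c \<le> a" using c by (simp_all add: a_def)
    then have b: "0 \<le> b" "b \<le> 1" "a * b = c" using c by (auto simp: b_def)
    define \<mu> where "\<mu> z = mix_pmf b (lazy_walk E w' \<alpha> z) (return_pmf z)" for z
    have fin\<mu>: "finite (set_pmf (\<mu> z))" if "z \<in> {x, y}" for z
      unfolding \<mu>_def using that \<alpha> by (intro finite_subset[OF set_mix_pmf]) (auto simp: finite_set_walk w')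
    have le: "a * pmf (\<mu> z) u \<le> pmf (lazy_walk E w \<alpha> z) u" if z: "z \<in> {x, y}" for z u
    proof (cases "u = z")
      case True
      have "a * pmf (\<mu> z) u = (a * b) * \<alpha> + (a - a * b)"
        using b z True unfolding \<mu>_def
        by (simp add: pmf_mix_pmf pmf_walk[OF w' \<alpha> z] algebra_simps)
      also have "\<dots> = \<alpha>" unfolding b(3) by (simp add: a_def algebra_simps)
      finally show ?thesis using True by (simp add: pmf_walk[OF w \<alpha> z])
    next
      case False
      have "a * pmf (\<mu> z) u = (a * b) * pmf (lazy_walk E w' \<alpha> z) u"
        using b False unfolding \<mu>_def by (simp add: pmf_mix_pmf)
      also have "\<dots> \<le> pmf (lazy_walk E w \<alpha> z) u"
        using dom[OF z, of u] \<alpha> False mult_left_mono[OF dom[OF z, of u], of "1 - \<alpha>"]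
        by (simp add: b pmf_walk[OF w \<alpha> z] pmf_walk[OF w' \<alpha> z] mult.left_commute)
      finally show ?thesis .
    qed
    have fin: "finite (set_pmf (lazy_walk E w \<alpha> z))" if "z \<in> {x, y}" for z
      using that \<alpha> by (intro finite_set_walk w) auto
    obtain q where q: "lazy_walk E w \<alpha> x = mix_pmf a (\<mu> x) q" "set_pmf q \<subseteq> set_pmf (lazy_walk E w \<alpha> x)"
      using ex_mix_pmf_of_dominated[of a "lazy_walk E w \<alpha> x" "\<mu> x"] a le fin by auto
    obtain r where r: "lazy_walk E w \<alpha> y = mix_pmf a (\<mu> y) r" "set_pmf r \<subseteq> set_pmf (lazy_walk E w \<alpha> y)"
      using ex_mix_pmf_of_dominated[of a "lazy_walk E w \<alpha> y" "\<mu> y"] a le fin by auto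
    let ?d = "\<lambda>u v. real (gdist E u v)"
    have "wasserstein1 ?d (\<mu> x) (\<mu> y) \<le> b * ?W' \<alpha> + (1 - b) * 1"
      unfolding \<mu>_def walk_distance_def using b \<alpha>
      by (intro wasserstein1_mix_le) (auto simp: finite_set_walk w' gdist_adj[OF edge ends_in_V(3)])
    then have "a * wasserstein1 ?d (\<mu> x) (\<mu> y) \<le> a * (b * ?W' \<alpha> + (1 - b) * 1)"
      using a by (intro mult_left_mono) auto
    also have "\<dots> = (a * b) * ?W' \<alpha> + (a - a * b)" by (simp add: algebra_simps)
    finally have 1: "a * wasserstein1 ?d (\<mu> x) (\<mu> y) \<le> c * ?W' \<alpha> + (a - c)" by (simp add: b)
    have "?d u v \<le> 3" if "u \<in> set_pmf q" "v \<in> set_pmf r" for u v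
      using gdist_balls_le[OF edge, of u v] that q(2) r(2) set_walk[OF w \<alpha>] by fastforce
    then have "?W \<alpha> \<le> a * wasserstein1 ?d (\<mu> x) (\<mu> y) + (1 - a) * 3"
      unfolding walk_distance_def q(1) r(1) using a fin\<mu> fin q(2) r(2)
      by (intro wasserstein1_mix_le) (auto intro: finite_subset)
    with 1 have "?W \<alpha> \<le> c * ?W' \<alpha> + (a - c) + (1 - a) * 3" by linarith
    \<comment> \<open>The error terms add up to \<open>(1 - c) * (1 + 2 * (1 - \<alpha>))\<close>.
      The shift 2 is therefore the cost 3 of a remainder minus the cost 1 of staying put.\<close>
    then have "c * ((1 - ?W' \<alpha>) + 2 * (1 - \<alpha>)) \<le> (1 - ?W \<alpha>) + 2 * (1 - \<alpha>)"
      by (simp add: a_def algebra_simps)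
    then have "c * ((1 - ?W' \<alpha>) + 2 * (1 - \<alpha>)) / (1 - \<alpha>) \<le> ((1 - ?W \<alpha>) + 2 * (1 - \<alpha>)) / (1 - \<alpha>)"
      using \<alpha> by (intro divide_right_mono) auto
    moreover have "(A + 2 * (1 - \<alpha>)) / (1 - \<alpha>) = A / (1 - \<alpha>) + 2" for A
      using \<alpha> by (simp add: field_simps)
    ultimately show ?thesis by (simp only: times_divide_eq_right[symmetric])
  qed
  show ?thesis
  proof (rule tendsto_le[OF trivial_limit_at_left_real])
    show "((\<lambda>\<alpha>. (1 - ?W \<alpha>) / (1 - \<alpha>) + 2) \<longlongrightarrow> lly_curvature E w x y + 2) (at_left 1)"
      by (intro tendsto_intros lly_curvature_tendsto w)
    show "((\<lambda>\<alpha>. c * ((1 - ?W' \<alpha>) / (1 - \<alpha>) + 2)) \<longlongrightarrow> c * (lly_curvature E w' x y + 2)) (at_left 1)"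
      by (intro tendsto_intros lly_curvature_tendsto w')
  qed (use main eventually_at_left_1 in \<open>auto elim: eventually_mono\<close>)
qed

lemma lly_curvature_diff_le_4:
  assumes w: "\<forall>e\<in>E. 0 < w e" and w': "\<forall>e\<in>E. 0 < w' e"
  shows "\<bar>lly_curvature E w x y - lly_curvature E w' x y\<bar> \<le> 4"
proof -
  \<comment> \<open>Domination with factor 0 is trivial and yields the lower bound -2 for the
    curvature.\<close>
  have "0 \<le> lly_curvature E v x y + 2" if v: "\<forall>e\<in>E. 0 < v e" for v
    using lly_curvature_dominated[of v v 0] v vertex_weight_pos[OF v]
    by (simp add: nbrs_def less_imp_le)
  from this[OF w] this[OF w'] show ?thesis
    using lly_curvature_le[OF w] lly_curvature_le[OF w'] by linarith
qed

text \<open>Edge weight and vertex weight each change by a factor of at most \<open>exp s\<close>,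
  so a transition probability loses at most the factor \<open>exp (-2 * s)\<close>. Then
  \<open>1 - exp (-2 * s) \<le> 2 * s\<close>, multiplied by the upper bound 4 for the shifted
  curvature, gives \<open>8 * s\<close>. Positivity of \<open>s\<close> keeps the factor strictly
  below 1.\<close>

lemma lly_curvature_diff_le:
  assumes w: "\<forall>e\<in>E. 0 < w e" and w': "\<forall>e\<in>E. 0 < w' e" and s: "0 < s"
    and close: "\<And>e. e \<in> E \<Longrightarrow> \<bar>ln (w e) - ln (w' e)\<bar> \<le> s"
  shows "\<bar>lly_curvature E w x y - lly_curvature E w' x y\<bar> \<le> 8 * s"
proof -
  have one_side: "lly_curvature E v' x y - lly_curvature E v x y \<le> 8 * s"
    if v: "\<forall>e\<in>E. 0 < v e" and v': "\<forall>e\<in>E. 0 < v' e"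
      and cl: "\<And>e. e \<in> E \<Longrightarrow> \<bar>ln (v e) - ln (v' e)\<bar> \<le> s" for v v'
  proof -
    have ratio: "u e \<le> exp s * u' e" if "0 < u e" "0 < u' e" "\<bar>ln (u e) - ln (u' e)\<bar> \<le> s"
      for u u' :: "'a set \<Rightarrow> real" and e
    proof -
      have "u e = exp (ln (u e))" using that by simp
      also have "\<dots> \<le> exp (s + ln (u' e))" using that by (subst exp_le_cancel_iff) linarith
      finally show ?thesis using that by (simp add: exp_add)
    qed
    have dom: "exp (-2 * s) * (v' {z, u} / vertex_weight E v' z) \<le> v {z, u} / vertex_weight E v z"
      if z: "z \<in> {x, y}" and u: "u \<in> nbrs E z" for z u
    proof -
      have e: "{z, u} \<in> E" using u by (simp add: nbrs_def)
      have m: "0 < vertex_weight E v z" "0 < vertex_weight E v' z"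
        using vertex_weight_pos v v' z by blast+
      have "vertex_weight E v z \<le> exp s * vertex_weight E v' z"
        unfolding vertex_weight_def sum_distrib_left
        using v v' cl by (intro sum_mono ratio) (auto simp: nbrs_def)
      moreover have "v' {z, u} \<le> exp s * v {z, u}"
        using v v' cl[OF e] e by (intro ratio) auto
      ultimately have "v' {z, u} * vertex_weight E v z
          \<le> (exp s * v {z, u}) * (exp s * vertex_weight E v' z)"
        using m v v' e by (intro mult_mono) (auto intro: less_imp_le)
      also have "\<dots> = exp (2 * s) * (v {z, u} * vertex_weight E v' z)"
        unfolding mult_2 exp_add by (simp only: mult_ac)
      finally have "v' {z, u} / vertex_weight E v' z \<le> exp (2 * s) * (v {z, u} / vertex_weight E v z)"
        using m by (simp add: field_simps)
      then have "exp (-2 * s) * (v' {z, u} / vertex_weight E v' z)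
          \<le> exp (-2 * s) * (exp (2 * s) * (v {z, u} / vertex_weight E v z))"
        by (rule mult_left_mono) simp
      then show ?thesis by (simp add: mult.assoc[symmetric] exp_add[symmetric])
    qed
    have c: "0 \<le> exp (-2 * s)" "exp (-2 * s) < 1" "1 - exp (-2 * s) \<le> 2 * s"
      using s exp_ge_add_one_self[of "-2 * s"] by auto
    have "exp (-2 * s) * (lly_curvature E v' x y + 2) \<le> lly_curvature E v x y + 2"
      using v v' c dom by (intro lly_curvature_dominated) auto
    then have "lly_curvature E v' x y - lly_curvature E v x y
        \<le> (1 - exp (-2 * s)) * (lly_curvature E v' x y + 2)"
      by (simp add: algebra_simps)
    also have "\<dots> \<le> (1 - exp (-2 * s)) * 4"
      using c lly_curvature_le[OF v'] by (intro mult_left_mono) auto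
    also have "\<dots> \<le> (2 * s) * 4"
      by (rule mult_right_mono[OF c(3)]) simp
    finally show ?thesis by simp
  qed
  show ?thesis
    using one_side[OF w w' close] one_side[OF w' w] close by (simp add: abs_minus_commute abs_le_iff)
qed

end

section \<open>Picard iteration and uniqueness\<close>

lemma abs_le_of_deriv_le:
  fixes f g :: "real \<Rightarrow> real"
  assumes "0 \<le> t" and cont: "continuous_on {0..t} f" "continuous_on {0..t} g"
    and f: "\<And>s. 0 < s \<Longrightarrow> s < t \<Longrightarrow> (f has_real_derivative f' s) (at s)"
    and g: "\<And>s. 0 < s \<Longrightarrow> s < t \<Longrightarrow> (g has_real_derivative g' s) (at s)"
    and le: "\<And>s. 0 < s \<Longrightarrow> s < t \<Longrightarrow> \<bar>f' s\<bar> \<le> g' s"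
    and init: "f 0 = 0" "g 0 = 0"
  shows "\<bar>f t\<bar> \<le> g t"
proof -
  \<comment> \<open>Both \<open>g - f\<close> and \<open>g + f\<close> start at 0 and are
    nondecreasing. Derivatives are used only in the open interval, since the flow equation is not
    imposed at time 0.\<close>
  have "(\<lambda>s. g s - f s) 0 \<le> (\<lambda>s. g s - f s) t"
  proof (rule DERIV_nonneg_imp_increasing_open[where f = "\<lambda>s. g s - f s"])
    show "\<exists>d. ((\<lambda>s. g s - f s) has_real_derivative d) (at s) \<and> 0 \<le> d" if "0 < s" "s < t" for s
      using DERIV_diff[OF g[OF that] f[OF that]] le[OF that] by (intro exI conjI) (assumption, linarith)
  qed (use assms(1) cont in \<open>auto intro!: continuous_intros\<close>)
  moreover have "(\<lambda>s. g s + f s) 0 \<le> (\<lambda>s. g s + f s) t"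
  proof (rule DERIV_nonneg_imp_increasing_open[where f = "\<lambda>s. g s + f s"])
    show "\<exists>d. ((\<lambda>s. g s + f s) has_real_derivative d) (at s) \<and> 0 \<le> d" if "0 < s" "s < t" for s
      using DERIV_add[OF g[OF that] f[OF that]] le[OF that] by (intro exI conjI) (assumption, linarith)
  qed (use assms(1) cont in \<open>auto intro!: continuous_intros\<close>)
  ultimately show ?thesis using init by simp
qed

text \<open>Induction on \<open>n\<close>. A bound on all log differences becomes, multiplied by 8,
  a bound on all curvature differences, and integrating from 0 gives the next bound. The division by
  2 reflects the starting bound 4 against the Lipschitz constant 8.\<close>

lemma ricci_flow_ln_diff_le:
  assumes G: "simple_graph V E" "locally_finite_graph V E"
    and sol: "ricci_flow_solution E \<kappa>s \<omega>0 \<omega>1" "ricci_flow_solution E \<kappa>s \<omega>0 \<omega>2"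
  shows "0 \<le> t \<Longrightarrow> e \<in> E \<Longrightarrow> \<bar>ln (\<omega>1 t e) - ln (\<omega>2 t e)\<bar> \<le> (8 * t) ^ Suc n / fact (Suc n) / 2"
proof -
  have pos: "0 < \<omega>1 s e'" "0 < \<omega>2 s e'" if "0 \<le> s" "e' \<in> E" for s e'
    using sol that unfolding ricci_flow_solution_def by auto
  \<comment> \<open>One integration step, shared by both cases of the induction: the base case
    supplies the constant bound 4, the other case the Lipschitz estimate.\<close>
  have step: "\<bar>ln (\<omega>1 t e) - ln (\<omega>2 t e)\<bar> \<le> (8 * t) ^ Suc n / fact (Suc n) / 2"
    if t: "0 \<le> t" and e: "e \<in> E"
      and bound: "\<And>s x y. 0 < s \<Longrightarrow> {x, y} \<in> E \<Longrightarrow>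
        \<bar>lly_curvature E (\<omega>1 s) x y - lly_curvature E (\<omega>2 s) x y\<bar> \<le> 4 * ((8 * s) ^ n / fact n)"
    for t e n
  proof -
    obtain x y where xy: "e = {x, y}" using G(1) e unfolding simple_graph_def by blast
    \<comment> \<open>Taking logarithms turns the flow into an equation whose prescribed term
      \<open>\<kappa>s e\<close> is the same for both solutions and cancels in the
      difference.\<close>
    have deriv: "((\<lambda>s. ln (\<omega> s e)) has_real_derivative - (lly_curvature E (\<omega> s) x y - \<kappa>s e)) (at s)"
      if "ricci_flow_solution E \<kappa>s \<omega>0 \<omega>" "0 < s" for \<omega> s
    proof -
      have p: "0 < \<omega> s e" using that e unfolding ricci_flow_solution_def by auto
      have "((\<lambda>s. \<omega> s e) has_real_derivative - (lly_curvature E (\<omega> s) x y - \<kappa>s e) * \<omega> s e) (at s)"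
        using that e xy unfolding ricci_flow_solution_def by blast
      from DERIV_chain2[where f = ln, OF DERIV_ln_divide[OF p] this] show ?thesis using p by simp
    qed
    have cont: "continuous_on {0..t} (\<lambda>s. ln (\<omega> s e))"
      if "ricci_flow_solution E \<kappa>s \<omega>0 \<omega>" for \<omega>
    proof (rule continuous_on_ln)
      have "continuous_on {0..} (\<lambda>s. \<omega> s e)"
        using that e unfolding ricci_flow_solution_def by blast
      then show "continuous_on {0..t} (\<lambda>s. \<omega> s e)"
        by (rule continuous_on_subset) auto
      show "\<forall>s\<in>{0..t}. \<omega> s e \<noteq> 0"
        using that e unfolding ricci_flow_solution_def by force
    qed
    show ?thesis
    proof (rule abs_le_of_deriv_le[where
          f = "\<lambda>s. ln (\<omega>1 s e) - ln (\<omega>2 s e)" and g = "\<lambda>s. (8 * s) ^ Suc n / fact (Suc n) / 2"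
          and f' = "\<lambda>s. - (lly_curvature E (\<omega>1 s) x y - \<kappa>s e) - - (lly_curvature E (\<omega>2 s) x y - \<kappa>s e)"
          and g' = "\<lambda>s. 4 * ((8 * s) ^ n / fact n)"])
      fix s :: real assume s: "0 < s" "s < t"
      show "((\<lambda>s. ln (\<omega>1 s e) - ln (\<omega>2 s e)) has_real_derivative
          - (lly_curvature E (\<omega>1 s) x y - \<kappa>s e) - - (lly_curvature E (\<omega>2 s) x y - \<kappa>s e)) (at s)"
        by (intro DERIV_diff deriv sol s)
      show "((\<lambda>s. (8 * s) ^ Suc n / fact (Suc n) / 2) has_real_derivative 4 * ((8 * s) ^ n / fact n)) (at s)"
      proof -
        have "((\<lambda>s. (8 * s) ^ Suc n / fact (Suc n) / 2) has_real_derivative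
            real (Suc n) * (8 * (8 * s) ^ n) / fact (Suc n) / 2) (at s)"
          by (rule derivative_eq_intros refl | simp)+
        also have "real (Suc n) * (8 * (8 * s) ^ n) / fact (Suc n) / 2 = 4 * ((8 * s) ^ n / fact n)"
          by (simp del: of_nat_Suc add: fact_Suc)
        finally show ?thesis .
      qed
      show "\<bar>- (lly_curvature E (\<omega>1 s) x y - \<kappa>s e) - - (lly_curvature E (\<omega>2 s) x y - \<kappa>s e)\<bar>
          \<le> 4 * ((8 * s) ^ n / fact n)"
        using bound[OF s(1)] e xy by (simp add: abs_minus_commute)
    next
      show "ln (\<omega>1 0 e) - ln (\<omega>2 0 e) = 0"
        using sol e unfolding ricci_flow_solution_def by simp
    qed (use t sol in \<open>auto intro!: continuous_intros cont\<close>)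
  qed
  show "0 \<le> t \<Longrightarrow> e \<in> E \<Longrightarrow> \<bar>ln (\<omega>1 t e) - ln (\<omega>2 t e)\<bar> \<le> (8 * t) ^ Suc n / fact (Suc n) / 2"
  proof (induction n arbitrary: t e)
    case 0
    show ?case
    proof (rule step[OF 0])
      fix s :: real and x y assume "0 < s" and xy: "{x, y} \<in> E"
      interpret graph_edge V E x y using G xy by unfold_locales
      show "\<bar>lly_curvature E (\<omega>1 s) x y - lly_curvature E (\<omega>2 s) x y\<bar> \<le> 4 * ((8 * s) ^ 0 / fact 0)"
        using lly_curvature_diff_le_4[of "\<omega>1 s" "\<omega>2 s"] pos \<open>0 < s\<close> by simp
    qed
  next
    case (Suc n)
    show ?case
    proof (rule step[OF Suc.prems])
      fix s :: real and x y assume s: "0 < s" and xy: "{x, y} \<in> E"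
      interpret graph_edge V E x y using G xy by unfold_locales
      have "\<bar>lly_curvature E (\<omega>1 s) x y - lly_curvature E (\<omega>2 s) x y\<bar>
          \<le> 8 * ((8 * s) ^ Suc n / fact (Suc n) / 2)"
        using s pos by (intro lly_curvature_diff_le Suc.IH divide_pos_pos zero_less_power) auto
      then show "\<bar>lly_curvature E (\<omega>1 s) x y - lly_curvature E (\<omega>2 s) x y\<bar>
          \<le> 4 * ((8 * s) ^ Suc n / fact (Suc n))"
        by (simp del: power_Suc fact_Suc add: mult_ac)
    qed
  qed
qed

theorem theorem1p2:
  fixes V :: "'a set" and E :: "'a set set"
    and \<kappa>s \<omega>0 :: "'a set \<Rightarrow> real"
    and \<omega>1 \<omega>2 :: "real \<Rightarrow> 'a set \<Rightarrow> real"
  assumes "simple_graph V E" and "infinite V"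
    and "connected_graph V E" and "locally_finite_graph V E"
    and "\<forall>e\<in>E. 0 < \<omega>0 e"
    and "bdd_above (vertex_degree E ` V)"
    and "bdd_above ((\<lambda>e. \<bar>\<kappa>s e\<bar>) ` E)"
    and "\<exists>\<delta>>0. \<forall>e\<in>E. inverse \<delta> \<le> \<omega>0 e \<and> \<omega>0 e \<le> \<delta>"
    and "ricci_flow_solution E \<kappa>s \<omega>0 \<omega>1"
    and "ricci_flow_solution E \<kappa>s \<omega>0 \<omega>2"
  shows "\<forall>t\<ge>0. \<forall>e\<in>E. \<omega>1 t e = \<omega>2 t e"
proof (intro allI impI ballI)
  fix t :: real and e assume t: "0 \<le> t" and e: "e \<in> E"
  \<comment> \<open>These are the terms of the exponential series at \<open>8 * t\<close>, so the
    iterated bounds vanish at each fixed time.\<close>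
  have "(\<lambda>n. (8 * t) ^ n / fact n) \<longlonglongrightarrow> 0"
    using summable_LIMSEQ_zero[OF summable_exp[of "8 * t"]] by (simp add: divide_inverse mult.commute)
  then have "(\<lambda>n. (8 * t) ^ Suc n / fact (Suc n) / 2) \<longlonglongrightarrow> 0"
    by (intro tendsto_divide_zero) (rule LIMSEQ_Suc)
  then have "\<bar>ln (\<omega>1 t e) - ln (\<omega>2 t e)\<bar> \<le> 0"
    by (rule LIMSEQ_le_const)
      (use ricci_flow_ln_diff_le[OF assms(1,4,9,10) t e] in blast)
  moreover have "0 < \<omega>1 t e" "0 < \<omega>2 t e"
    using assms(9,10) t e unfolding ricci_flow_solution_def by auto
  ultimately show "\<omega>1 t e = \<omega>2 t e" by simp
qed

end
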